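(* Let $X$ be a real Banach space and $J,Y$ closed subspaces with $J\subseteq Y\subseteq X$, where $J$ is an $M$-ideal in $X$. If $Y/J$ has property-$(HB)$ in $X/J$, then $Y$ has property-$(HB)$ in $X$.
   Context: For a closed subspace $V$ of a Banach space $E$, $V^\perp=\{e^*\in E^*:e^*|_V=0\}$. $J$ is an $M$-ideal in $X$ if there is a closed subspace $W$ of $X^*$ with $X^*=J^\perp\oplus W$ and $\|u+w\|=\|u\|+\|w\|$ for $u\in J^\perp,w\in W$. $V$ has property-$(HB)$ in $E$ if there is a linear projection $P$ on $E^*$ with range $V^\perp$ and $\|P\|=1$ such that, writing $G=(I-P)(E^* )$, for every $e^*=v^\#+v^\perp$ with $v^\#\in G$, $0\neq v^\perp\in V^\perp$, one has $\|e^*\|>\|v^\#\|$ and $\|e^*\|\ge\|v^\perp\|$. $Y/J$ is regarded as a subspace of $X/J$ with the quotient norm. *)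

theory Defs
  imports "HOL-Analysis.Analysis"
begin

text \<open>A normed space is presented abstractly by a carrier S, an addition, a real
scalar multiplication and a norm N.  Its dual is the set of bounded linear
functionals on S (extended by 0 outside S, so that equality is extensional).\<close>

definition lin_on :: "'v set \<Rightarrow> ('v \<Rightarrow> 'v \<Rightarrow> 'v) \<Rightarrow> (real \<Rightarrow> 'v \<Rightarrow> 'v) \<Rightarrow> ('v \<Rightarrow> real) \<Rightarrow> bool" where
  "lin_on S add sc f \<longleftrightarrow>
     (\<forall>x\<in>S. \<forall>y\<in>S. f (add x y) = f x + f y) \<and> (\<forall>x\<in>S. \<forall>c. f (sc c x) = c * f x)"

definition dual_sp :: "'v set \<Rightarrow> ('v \<Rightarrow> 'v \<Rightarrow> 'v) \<Rightarrow> (real \<Rightarrow> 'v \<Rightarrow> 'v) \<Rightarrow> ('v \<Rightarrow> real) \<Rightarrow> ('v \<Rightarrow> real) set" where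
  "dual_sp S add sc N = {f. lin_on S add sc f \<and> (\<exists>C. \<forall>x\<in>S. \<bar>f x\<bar> \<le> C * N x) \<and> (\<forall>x. x \<notin> S \<longrightarrow> f x = 0)}"

text \<open>Dual norm: sup of |f x| over the closed unit ball.\<close>
definition dnorm :: "'v set \<Rightarrow> ('v \<Rightarrow> real) \<Rightarrow> ('v \<Rightarrow> real) \<Rightarrow> real" where
  "dnorm S N f = Sup {\<bar>f x\<bar> | x. x \<in> S \<and> N x \<le> 1}"

text \<open>Annihilator V^perp.\<close>
definition annih :: "'v set \<Rightarrow> ('v \<Rightarrow> 'v \<Rightarrow> 'v) \<Rightarrow> (real \<Rightarrow> 'v \<Rightarrow> 'v) \<Rightarrow> ('v \<Rightarrow> real) \<Rightarrow> 'v set \<Rightarrow> ('v \<Rightarrow> real) set" where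
  "annih S add sc N V = {f \<in> dual_sp S add sc N. \<forall>v\<in>V. f v = 0}"

definition fadd :: "('v \<Rightarrow> real) \<Rightarrow> ('v \<Rightarrow> real) \<Rightarrow> 'v \<Rightarrow> real" where
  "fadd f g = (\<lambda>x. f x + g x)"

definition fscale :: "real \<Rightarrow> ('v \<Rightarrow> real) \<Rightarrow> 'v \<Rightarrow> real" where
  "fscale c f = (\<lambda>x. c * f x)"

definition fminus :: "('v \<Rightarrow> real) \<Rightarrow> ('v \<Rightarrow> real) \<Rightarrow> 'v \<Rightarrow> real" where
  "fminus f g = (\<lambda>x. f x - g x)"

text \<open>Property-(HB) of V in the normed space E = (S, add, sc, N).\<close>
definition has_HB :: "'v set \<Rightarrow> ('v \<Rightarrow> 'v \<Rightarrow> 'v) \<Rightarrow> (real \<Rightarrow> 'v \<Rightarrow> 'v) \<Rightarrow> ('v \<Rightarrow> real) \<Rightarrow> 'v set \<Rightarrow> bool" where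
  "has_HB S add sc N V \<longleftrightarrow>
    (\<exists>P. (\<forall>f\<in>dual_sp S add sc N. P f \<in> dual_sp S add sc N)
       \<and> (\<forall>f\<in>dual_sp S add sc N. \<forall>g\<in>dual_sp S add sc N. P (fadd f g) = fadd (P f) (P g))
       \<and> (\<forall>f\<in>dual_sp S add sc N. \<forall>c. P (fscale c f) = fscale c (P f))
       \<and> (\<forall>f\<in>dual_sp S add sc N. P (P f) = P f)
       \<and> P ` dual_sp S add sc N = annih S add sc N V
       \<and> bdd_above {dnorm S N (P f) | f. f \<in> dual_sp S add sc N \<and> dnorm S N f \<le> 1}
       \<and> Sup {dnorm S N (P f) | f. f \<in> dual_sp S add sc N \<and> dnorm S N f \<le> 1} = 1
       \<and> (\<forall>g \<in> (\<lambda>f. fminus f (P f)) ` dual_sp S add sc N. \<forall>u \<in> annih S add sc N V.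
            u \<noteq> (\<lambda>x. 0) \<longrightarrow>
              dnorm S N (fadd g u) > dnorm S N g \<and> dnorm S N (fadd g u) \<ge> dnorm S N u))"

text \<open>Concrete instances: X itself, and the quotient X/J realized as cosets.\<close>
abbreviation Xdual :: "('a::real_normed_vector \<Rightarrow> real) set" where
  "Xdual \<equiv> dual_sp UNIV (+) (*\<^sub>R) norm"

abbreviation Xdnorm :: "('a::real_normed_vector \<Rightarrow> real) \<Rightarrow> real" where
  "Xdnorm \<equiv> dnorm UNIV norm"

definition M_ideal :: "'a::real_normed_vector set \<Rightarrow> bool" where
  "M_ideal J \<longleftrightarrow>
    (\<exists>W. W \<subseteq> Xdual
       \<and> (\<lambda>x. 0) \<in> W \<and> (\<forall>f\<in>W. \<forall>g\<in>W. fadd f g \<in> W) \<and> (\<forall>f\<in>W. \<forall>c. fscale c f \<in> W)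
       \<and> (\<forall>f\<in>Xdual. (\<forall>e>0. \<exists>w\<in>W. Xdnorm (fminus f w) < e) \<longrightarrow> f \<in> W)
       \<and> (\<forall>f\<in>Xdual. \<exists>u\<in>annih UNIV (+) (*\<^sub>R) norm J. \<exists>w\<in>W. f = fadd u w)
       \<and> annih UNIV (+) (*\<^sub>R) norm J \<inter> W = {\<lambda>x. 0}
       \<and> (\<forall>u\<in>annih UNIV (+) (*\<^sub>R) norm J. \<forall>w\<in>W. Xdnorm (fadd u w) = Xdnorm u + Xdnorm w))"

definition coset :: "'a::real_vector set \<Rightarrow> 'a \<Rightarrow> 'a set" where
  "coset J x = (\<lambda>j. x + j) ` J"

definition quot_carrier :: "'a::real_vector set \<Rightarrow> 'a set set" where
  "quot_carrier J = range (coset J)"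

definition qadd :: "'a::real_vector set \<Rightarrow> 'a set \<Rightarrow> 'a set \<Rightarrow> 'a set" where
  "qadd J A B = {a + b + j | a b j. a \<in> A \<and> b \<in> B \<and> j \<in> J}"

definition qscale :: "'a::real_vector set \<Rightarrow> real \<Rightarrow> 'a set \<Rightarrow> 'a set" where
  "qscale J c A = {c *\<^sub>R a + j | a j. a \<in> A \<and> j \<in> J}"

text \<open>Quotient norm: inf of the norms of the representatives.\<close>
definition qnorm :: "'a::real_normed_vector set \<Rightarrow> real" where
  "qnorm A = Inf (norm ` A)"

end

theory Submission
  imports Defs
begin

(* Since J is an M-ideal, its annihilator J^perp is an L-summand of X*: there is a linear
   projection L of X* onto J^perp with ||f|| = ||L f|| + ||f - L f||.  Composition with the
   quotient map identifies (X/J)* isometrically with J^perp, and (Y/J)^perp with Y^perp.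
   Transporting the HB-projection Q of Y/J along this identification and precomposing with L
   gives a norm-one projection P of X* onto Y^perp.  Writing f - P f = (L f - P f) + (f - L f),
   the first summand lies in J^perp and corresponds to q - Q q, where q is the functional
   induced by L f on X/J, so the L-decomposition reduces the HB inequalities for P to those
   for Q. *)

lemma fminus_eq_fadd_fscale: "fminus f g = fadd f (fscale (-1) g)"
  by (simp add: fminus_def fadd_def fscale_def fun_eq_iff)

lemma dual_sp_fadd:
  assumes "f \<in> dual_sp S add sc N" "g \<in> dual_sp S add sc N"
  shows "fadd f g \<in> dual_sp S add sc N"
proof -
  obtain C D where "\<forall>x\<in>S. \<bar>f x\<bar> \<le> C * N x" "\<forall>x\<in>S. \<bar>g x\<bar> \<le> D * N x"
    using assms by (auto simp: dual_sp_def)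
  then have "\<forall>x\<in>S. \<bar>f x + g x\<bar> \<le> (C + D) * N x"
    by (auto simp: distrib_right intro: order_trans[OF abs_triangle_ineq add_mono])
  moreover have "lin_on S add sc (fadd f g)"
    using assms by (simp add: dual_sp_def lin_on_def fadd_def distrib_left)
  ultimately show ?thesis
    using assms unfolding dual_sp_def fadd_def by (auto intro!: exI[where x="C + D"])
qed

lemma dual_sp_fscale:
  assumes "f \<in> dual_sp S add sc N"
  shows "fscale c f \<in> dual_sp S add sc N"
proof -
  obtain C where "\<forall>x\<in>S. \<bar>f x\<bar> \<le> C * N x"
    using assms by (auto simp: dual_sp_def)
  then have "\<forall>x\<in>S. \<bar>c * f x\<bar> \<le> (\<bar>c\<bar> * C) * N x"
    by (simp add: abs_mult mult.assoc mult_left_mono)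
  moreover have "lin_on S add sc (fscale c f)"
    using assms by (simp add: dual_sp_def lin_on_def fscale_def distrib_left)
  ultimately show ?thesis
    using assms unfolding dual_sp_def fscale_def by (auto intro!: exI[where x="\<bar>c\<bar> * C"])
qed

lemma dual_sp_fminus:
  "f \<in> dual_sp S add sc N \<Longrightarrow> g \<in> dual_sp S add sc N \<Longrightarrow> fminus f g \<in> dual_sp S add sc N"
  unfolding fminus_eq_fadd_fscale by (intro dual_sp_fadd dual_sp_fscale)

lemma annih_fadd:
  "f \<in> annih S add sc N V \<Longrightarrow> g \<in> annih S add sc N V \<Longrightarrow> fadd f g \<in> annih S add sc N V"
  using dual_sp_fadd[of f S add sc N g] by (auto simp: annih_def fadd_def)

lemma annih_fscale: "f \<in> annih S add sc N V \<Longrightarrow> fscale c f \<in> annih S add sc N V"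
  using dual_sp_fscale[of f S add sc N c] by (auto simp: annih_def fscale_def)

lemma annih_fminus:
  "f \<in> annih S add sc N V \<Longrightarrow> g \<in> annih S add sc N V \<Longrightarrow> fminus f g \<in> annih S add sc N V"
  unfolding fminus_eq_fadd_fscale by (intro annih_fadd annih_fscale)

lemma annih_antimono: "V \<subseteq> V' \<Longrightarrow> annih S add sc N V' \<subseteq> annih S add sc N V"
  by (auto simp: annih_def)

abbreviation Xannih :: "'a::real_normed_vector set \<Rightarrow> ('a \<Rightarrow> real) set" where
  "Xannih V \<equiv> annih UNIV (+) (*\<^sub>R) norm V"

lemma Xdual_linear:
  assumes "u \<in> (Xdual :: ('a::real_normed_vector \<Rightarrow> real) set)"
  shows "u (x + y) = u x + u y" and "u (c *\<^sub>R x) = c * u x" and "u 0 = 0"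
    and "u (x - y) = u x - u y"
proof -
  have add: "\<And>x y. u (x + y) = u x + u y" and scale: "\<And>c x. u (c *\<^sub>R x) = c * u x"
    using assms by (simp_all add: dual_sp_def lin_on_def)
  show "u (x + y) = u x + u y" "u (c *\<^sub>R x) = c * u x" by (fact add scale)+
  show "u 0 = 0" using scale[of 0 0] by simp
  show "u (x - y) = u x - u y" using add[of x "-y"] scale[of "-1" y] by simp
qed

lemma abs_le_Xdnorm:
  assumes "u \<in> (Xdual :: ('a::real_normed_vector \<Rightarrow> real) set)" "norm x \<le> 1"
  shows "\<bar>u x\<bar> \<le> Xdnorm u"
proof -
  obtain C where C: "\<And>x. \<bar>u x\<bar> \<le> C * norm x"
    using assms(1) by (auto simp: dual_sp_def)
  have "\<bar>u y\<bar> \<le> max C 0" if "norm y \<le> 1" for y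
    using C[of y] mult_mono[OF _ that, of C "max C 0"] by simp
  then have "bdd_above {\<bar>u y\<bar> | y. y \<in> UNIV \<and> norm y \<le> 1}"
    by (auto intro!: bdd_aboveI[where M="max C 0"])
  then show ?thesis
    unfolding dnorm_def using assms(2) by (auto intro!: cSup_upper)
qed

lemma Xdnorm_nonneg: "u \<in> (Xdual :: ('a::real_normed_vector \<Rightarrow> real) set) \<Longrightarrow> 0 \<le> Xdnorm u"
  using abs_le_Xdnorm[of u 0] by simp

lemma abs_le_Xdnorm_mult_norm:
  assumes "u \<in> (Xdual :: ('a::real_normed_vector \<Rightarrow> real) set)"
  shows "\<bar>u x\<bar> \<le> Xdnorm u * norm x"
proof (cases "x = 0")
  case True
  then show ?thesis using Xdual_linear(3)[OF assms] by simp
next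
  case False
  then have "\<bar>u ((1 / norm x) *\<^sub>R x)\<bar> \<le> Xdnorm u"
    using abs_le_Xdnorm[OF assms] by simp
  then show ?thesis
    using Xdual_linear(2)[OF assms, of "1 / norm x" x] False
    by (simp add: abs_mult field_simps)
qed

lemma coset_self: "subspace J \<Longrightarrow> x \<in> coset J x"
  unfolding coset_def using subspace_0 by force

lemma mem_coset_iff: "a \<in> coset J x \<longleftrightarrow> a - x \<in> J"
  unfolding coset_def by (auto simp: image_iff intro!: bexI[where x="a - x"])

lemma coset_in_quot_carrier [simp]: "coset J x \<in> quot_carrier J"
  unfolding quot_carrier_def by simp

lemma quot_carrierE:
  assumes "A \<in> quot_carrier J"
  obtains x where "A = coset J x"
  using assms unfolding quot_carrier_def by blast

lemma coset_eqI:
  assumes "subspace J" "a - x \<in> J"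
  shows "coset J a = coset J x"
proof -
  have "z - a \<in> J \<longleftrightarrow> z - x \<in> J" for z
    using assms subspace_add[of J "z - a" "a - x"] subspace_diff[of J "z - x" "a - x"]
    by (auto simp: algebra_simps)
  then show ?thesis by (auto simp: mem_coset_iff)
qed

lemma qadd_coset:
  assumes "subspace J"
  shows "qadd J (coset J x) (coset J y) = coset J (x + y)"
proof (rule set_eqI)
  fix z
  have "z \<in> qadd J (coset J x) (coset J y) \<longleftrightarrow>
      (\<exists>a b j. z - (x + y) = (a - x) + (b - y) + j \<and> a - x \<in> J \<and> b - y \<in> J \<and> j \<in> J)"
    unfolding qadd_def mem_coset_iff by (auto simp: algebra_simps)
  also have "\<dots> \<longleftrightarrow> z - (x + y) \<in> J"
  proof
    assume "z - (x + y) \<in> J"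
    then show "\<exists>a b j. z - (x + y) = (a - x) + (b - y) + j \<and> a - x \<in> J \<and> b - y \<in> J \<and> j \<in> J"
      using subspace_0[OF assms] by (metis add_0 diff_self)
  qed (metis subspace_add[OF assms])
  finally show "z \<in> qadd J (coset J x) (coset J y) \<longleftrightarrow> z \<in> coset J (x + y)"
    by (simp add: mem_coset_iff)
qed

lemma qscale_coset:
  assumes "subspace J"
  shows "qscale J c (coset J x) = coset J (c *\<^sub>R x)"
proof (rule set_eqI)
  fix z
  have "z \<in> qscale J c (coset J x) \<longleftrightarrow>
      (\<exists>a j. z - c *\<^sub>R x = c *\<^sub>R (a - x) + j \<and> a - x \<in> J \<and> j \<in> J)"
    unfolding qscale_def mem_coset_iff by (auto simp: algebra_simps)
  also have "\<dots> \<longleftrightarrow> z - c *\<^sub>R x \<in> J"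
  proof
    assume "z - c *\<^sub>R x \<in> J"
    then show "\<exists>a j. z - c *\<^sub>R x = c *\<^sub>R (a - x) + j \<and> a - x \<in> J \<and> j \<in> J"
      using subspace_0[OF assms] by (metis add_0 diff_self scale_zero_right)
  qed (metis subspace_add[OF assms] subspace_scale[OF assms])
  finally show "z \<in> qscale J c (coset J x) \<longleftrightarrow> z \<in> coset J (c *\<^sub>R x)"
    by (simp add: mem_coset_iff)
qed

lemma qnorm_le_norm: "a \<in> A \<Longrightarrow> qnorm A \<le> norm (a :: 'a::real_normed_vector)"
  unfolding qnorm_def by (auto intro!: cInf_lower bdd_belowI[where m=0])

lemma qnorm_coset_le_norm:
  "subspace J \<Longrightarrow> qnorm (coset J x) \<le> norm (x :: 'a::real_normed_vector)"
  using qnorm_le_norm coset_self by blast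

lemma qnorm_coset_nonneg: "subspace J \<Longrightarrow> 0 \<le> qnorm (coset J (x :: 'a::real_normed_vector))"
  unfolding qnorm_def using coset_self by (auto intro!: cInf_greatest)

abbreviation quot_dual :: "'a::real_normed_vector set \<Rightarrow> ('a set \<Rightarrow> real) set" where
  "quot_dual J \<equiv> dual_sp (quot_carrier J) (qadd J) (qscale J) qnorm"

abbreviation quot_dnorm :: "'a::real_normed_vector set \<Rightarrow> ('a set \<Rightarrow> real) \<Rightarrow> real" where
  "quot_dnorm J \<equiv> dnorm (quot_carrier J) qnorm"

text \<open>Mutually inverse isometries between the annihilator of J and the dual of X/J.
  quot_functional evaluates at an arbitrary representative, which is well defined on the
  annihilator, and is zero off the carrier, as membership in dual_sp requires.\<close>

definition quot_functional :: "'a::real_vector set \<Rightarrow> ('a \<Rightarrow> real) \<Rightarrow> 'a set \<Rightarrow> real" where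
  "quot_functional J u A = (if A \<in> quot_carrier J then u (SOME a. a \<in> A) else 0)"

definition lift_functional :: "'a::real_vector set \<Rightarrow> ('a set \<Rightarrow> real) \<Rightarrow> 'a \<Rightarrow> real" where
  "lift_functional J p x = p (coset J x)"

lemma Xannih_eq_on_coset:
  assumes "subspace J" "u \<in> Xannih J" "a \<in> coset J x"
  shows "u a = u x"
proof -
  have "u (a - x) = 0" using assms(2,3) by (simp add: annih_def mem_coset_iff)
  then show ?thesis using Xdual_linear(4)[of u a x] assms(2) by (simp add: annih_def)
qed

lemma quot_functional_coset:
  assumes "subspace J" "u \<in> Xannih J"
  shows "quot_functional J u (coset J x) = u x"
proof -
  have "(SOME a. a \<in> coset J x) \<in> coset J x" using coset_self[OF assms(1)] by (rule someI)
  then show ?thesis unfolding quot_functional_def using Xannih_eq_on_coset[OF assms] by simp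
qed

lemma abs_quot_functional_le:
  assumes "subspace J" "u \<in> Xannih J"
  shows "\<bar>quot_functional J u (coset J x)\<bar> \<le> Xdnorm u * qnorm (coset J x)"
proof -
  have u: "u \<in> Xdual" using assms(2) by (simp add: annih_def)
  have bound: "\<bar>u x\<bar> \<le> Xdnorm u * norm a" if "a \<in> coset J x" for a
    using Xannih_eq_on_coset[OF assms that] abs_le_Xdnorm_mult_norm[OF u, of a] by simp
  show ?thesis
  proof (cases "Xdnorm u = 0")
    case True
    then show ?thesis using bound[OF coset_self[OF assms(1)]] quot_functional_coset[OF assms] by simp
  next
    case False
    then have pos: "Xdnorm u > 0" using Xdnorm_nonneg[OF u] by simp
    have "\<bar>u x\<bar> / Xdnorm u \<le> qnorm (coset J x)"
      unfolding qnorm_def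
    proof (rule cInf_greatest)
      show "norm ` coset J x \<noteq> {}" using coset_self[OF assms(1)] by blast
    next
      fix r assume "r \<in> norm ` coset J x"
      then show "\<bar>u x\<bar> / Xdnorm u \<le> r" using bound pos by (auto simp: divide_le_eq mult.commute)
    qed
    then show ?thesis using pos quot_functional_coset[OF assms] by (simp add: divide_le_eq mult.commute)
  qed
qed

lemma quot_functional_in_quot_dual:
  assumes "subspace J" "u \<in> Xannih J"
  shows "quot_functional J u \<in> quot_dual J"
proof -
  have u: "u \<in> Xdual" using assms(2) by (simp add: annih_def)
  have "lin_on (quot_carrier J) (qadd J) (qscale J) (quot_functional J u)"
    unfolding lin_on_def
    by (auto elim!: quot_carrierE simp: qadd_coset[OF assms(1)] qscale_coset[OF assms(1)]
        quot_functional_coset[OF assms] Xdual_linear[OF u])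
  moreover have "\<forall>A\<in>quot_carrier J. \<bar>quot_functional J u A\<bar> \<le> Xdnorm u * qnorm A"
    using abs_quot_functional_le[OF assms] by (auto elim: quot_carrierE)
  ultimately show ?thesis unfolding dual_sp_def by (auto simp: quot_functional_def)
qed

lemma quot_dnorm_quot_functional:
  assumes "subspace J" "u \<in> Xannih J"
  shows "quot_dnorm J (quot_functional J u) = Xdnorm u"
proof -
  have u: "u \<in> Xdual" using assms(2) by (simp add: annih_def)
  let ?B = "{\<bar>quot_functional J u A\<bar> | A. A \<in> quot_carrier J \<and> qnorm A \<le> 1}"
  have B_le: "r \<le> Xdnorm u" if "r \<in> ?B" for r
  proof -
    obtain x where x: "r = \<bar>quot_functional J u (coset J x)\<bar>" "qnorm (coset J x) \<le> 1"
      using \<open>r \<in> ?B\<close> by (auto elim: quot_carrierE)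
    have "r \<le> Xdnorm u * qnorm (coset J x)" using x(1) abs_quot_functional_le[OF assms] by simp
    also have "\<dots> \<le> Xdnorm u" using x(2) Xdnorm_nonneg[OF u] by (simp add: mult_left_le)
    finally show ?thesis .
  qed
  have coset_in_B: "\<bar>u x\<bar> \<in> ?B" if "norm x \<le> 1" for x
    using that quot_functional_coset[OF assms, of x] qnorm_coset_le_norm[OF assms(1), of x]
    by (auto intro!: exI[where x="coset J x"])
  have "Sup ?B \<le> Xdnorm u"
    using coset_in_B[of 0] B_le by (intro cSup_least) auto
  moreover have "Xdnorm u \<le> Sup ?B"
    unfolding dnorm_def
  proof (rule cSup_least)
    show "{\<bar>u x\<bar> | x. x \<in> UNIV \<and> norm x \<le> 1} \<noteq> {}"
      by (auto intro!: exI[where x=0])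
  next
    fix r assume "r \<in> {\<bar>u x\<bar> | x. x \<in> UNIV \<and> norm x \<le> 1}"
    then show "r \<le> Sup ?B"
      using coset_in_B B_le by (intro cSup_upper) (auto intro!: bdd_aboveI[where M="Xdnorm u"])
  qed
  ultimately show ?thesis unfolding dnorm_def by simp
qed

lemma lift_functional_in_Xannih:
  assumes "subspace J" "p \<in> quot_dual J"
  shows "lift_functional J p \<in> Xannih J"
proof -
  have add: "p (qadd J A B) = p A + p B" if "A \<in> quot_carrier J" "B \<in> quot_carrier J" for A B
    using assms(2) that by (auto simp: dual_sp_def lin_on_def)
  have scale: "p (qscale J c A) = c * p A" if "A \<in> quot_carrier J" for A c
    using assms(2) that by (auto simp: dual_sp_def lin_on_def)
  obtain C where C: "\<forall>A\<in>quot_carrier J. \<bar>p A\<bar> \<le> C * qnorm A"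
    using assms(2) by (auto simp: dual_sp_def)
  have "lin_on UNIV (+) (*\<^sub>R) (lift_functional J p)"
    unfolding lin_on_def lift_functional_def
    by (simp add: add scale flip: qadd_coset[OF assms(1)] qscale_coset[OF assms(1)])
  moreover have "\<bar>lift_functional J p x\<bar> \<le> max C 0 * norm x" for x
  proof -
    have "\<bar>lift_functional J p x\<bar> \<le> C * qnorm (coset J x)"
      using C by (simp add: lift_functional_def)
    also have "\<dots> \<le> max C 0 * qnorm (coset J x)"
      using qnorm_coset_nonneg[OF assms(1)] by (simp add: mult_right_mono)
    also have "\<dots> \<le> max C 0 * norm x"
      using qnorm_coset_le_norm[OF assms(1)] by (simp add: mult_left_mono)
    finally show ?thesis .
  qed
  moreover have "lift_functional J p j = 0" if "j \<in> J" for j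
  proof -
    have "coset J j = qscale J 0 (coset J 0)"
      using coset_eqI[OF assms(1)] that by (simp add: qscale_coset[OF assms(1)])
    then show ?thesis using scale[of "coset J 0" 0] by (simp add: lift_functional_def)
  qed
  ultimately show ?thesis unfolding annih_def dual_sp_def by blast
qed

lemma lift_quot_functional:
  "subspace J \<Longrightarrow> u \<in> Xannih J \<Longrightarrow> lift_functional J (quot_functional J u) = u"
  by (simp add: lift_functional_def quot_functional_coset fun_eq_iff)

lemma quot_functional_nonzero:
  assumes "subspace J" "u \<in> Xannih J" "u \<noteq> (\<lambda>x. 0)"
  shows "quot_functional J u \<noteq> (\<lambda>x. 0)"
proof
  assume "quot_functional J u = (\<lambda>x. 0)"
  then have "lift_functional J (quot_functional J u) = (\<lambda>x. 0)"
    by (simp add: lift_functional_def fun_eq_iff)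
  then show False using lift_quot_functional[OF assms(1,2)] assms(3) by simp
qed

lemma quot_lift_functional:
  assumes "subspace J" "p \<in> quot_dual J"
  shows "quot_functional J (lift_functional J p) = p"
proof
  fix A
  show "quot_functional J (lift_functional J p) A = p A"
  proof (cases "A \<in> quot_carrier J")
    case True
    then show ?thesis
      using quot_functional_coset[OF assms(1) lift_functional_in_Xannih[OF assms]]
      by (auto elim: quot_carrierE simp: lift_functional_def)
  next
    case False
    then show ?thesis using assms(2) by (simp add: quot_functional_def dual_sp_def)
  qed
qed

lemma Xdnorm_lift_functional:
  "subspace J \<Longrightarrow> p \<in> quot_dual J \<Longrightarrow> Xdnorm (lift_functional J p) = quot_dnorm J p"
  using quot_dnorm_quot_functional lift_functional_in_Xannih quot_lift_functional by metis

lemma quot_functional_fadd: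
    "quot_functional J (fadd u v) = fadd (quot_functional J u) (quot_functional J v)"
  and quot_functional_fminus:
    "quot_functional J (fminus u v) = fminus (quot_functional J u) (quot_functional J v)"
  and quot_functional_fscale: "quot_functional J (fscale c u) = fscale c (quot_functional J u)"
  by (auto simp: quot_functional_def fadd_def fminus_def fscale_def fun_eq_iff)

lemma lift_functional_fadd:
    "lift_functional J (fadd p q) = fadd (lift_functional J p) (lift_functional J q)"
  and lift_functional_fscale: "lift_functional J (fscale c p) = fscale c (lift_functional J p)"
  by (auto simp: lift_functional_def fadd_def fscale_def fun_eq_iff)

lemma quot_functional_in_annih_coset_image:
  assumes "subspace J" "J \<subseteq> Y" "v \<in> Xannih Y"
  shows "quot_functional J v \<in> annih (quot_carrier J) (qadd J) (qscale J) qnorm (coset J ` Y)"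
proof -
  have "v \<in> Xannih J" using annih_antimono[OF assms(2)] assms(3) by blast
  then show ?thesis
    using assms(3) quot_functional_in_quot_dual[OF assms(1)] quot_functional_coset[OF assms(1)]
    by (auto simp: annih_def)
qed

lemma lift_functional_in_Xannih_of_coset_image:
  assumes "subspace J" "p \<in> annih (quot_carrier J) (qadd J) (qscale J) qnorm (coset J ` Y)"
  shows "lift_functional J p \<in> Xannih Y"
  using assms lift_functional_in_Xannih[OF assms(1)]
  by (auto simp: annih_def lift_functional_def)

locale L_projection =
  fixes J :: "'a::real_normed_vector set" and L :: "('a \<Rightarrow> real) \<Rightarrow> 'a \<Rightarrow> real"
  assumes L_in_Xannih: "f \<in> Xdual \<Longrightarrow> L f \<in> Xannih J"
    and L_Xannih: "u \<in> Xannih J \<Longrightarrow> L u = u"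
    and L_fadd: "f \<in> Xdual \<Longrightarrow> g \<in> Xdual \<Longrightarrow> L (fadd f g) = fadd (L f) (L g)"
    and L_fscale: "f \<in> Xdual \<Longrightarrow> L (fscale c f) = fscale c (L f)"
    and Xdnorm_L_split: "f \<in> Xdual \<Longrightarrow> Xdnorm f = Xdnorm (L f) + Xdnorm (fminus f (L f))"
begin

lemma L_in_Xdual: "f \<in> Xdual \<Longrightarrow> L f \<in> Xdual"
  using L_in_Xannih by (simp add: annih_def)

lemma L_complement_in_Xdual: "f \<in> Xdual \<Longrightarrow> fminus f (L f) \<in> Xdual"
  by (simp add: L_in_Xdual dual_sp_fminus)

lemma Xdnorm_L_le: "f \<in> Xdual \<Longrightarrow> Xdnorm (L f) \<le> Xdnorm f"
  using Xdnorm_L_split[of f] Xdnorm_nonneg[OF L_complement_in_Xdual, of f] by linarith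

lemma L_complement:
  assumes "f \<in> Xdual"
  shows "L (fminus f (L f)) = (\<lambda>x. 0)"
proof -
  have "L (fminus f (L f)) = fadd (L f) (fscale (-1) (L (L f)))"
    unfolding fminus_eq_fadd_fscale using assms
    by (simp add: L_fadd L_fscale L_in_Xdual dual_sp_fscale)
  then show ?thesis using L_Xannih[OF L_in_Xannih[OF assms]] by (simp add: fadd_def fscale_def)
qed

lemma Xdnorm_fadd_L_complement:
  assumes "f \<in> Xdual" "u \<in> Xannih J"
  shows "Xdnorm (fadd u (fminus f (L f))) = Xdnorm u + Xdnorm (fminus f (L f))"
proof -
  let ?w = "fminus f (L f)"
  have u: "u \<in> Xdual" using assms(2) by (simp add: annih_def)
  have sum: "fadd u ?w \<in> Xdual" by (simp add: u assms(1) L_complement_in_Xdual dual_sp_fadd)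
  have "L (fadd u ?w) = u"
    using L_fadd[OF u L_complement_in_Xdual[OF assms(1)]] L_complement[OF assms(1)]
      L_Xannih[OF assms(2)]
    by (simp add: fadd_def)
  moreover have "fminus (fadd u ?w) u = ?w" by (simp add: fadd_def fminus_def)
  ultimately show ?thesis using Xdnorm_L_split[OF sum] by simp
qed

end

lemma direct_sum_component_unique:
  assumes "U \<inter> W = {\<lambda>x. 0}"
    and "\<And>f g. f \<in> U \<Longrightarrow> g \<in> U \<Longrightarrow> fminus f g \<in> U"
    and "\<And>f g. f \<in> W \<Longrightarrow> g \<in> W \<Longrightarrow> fminus f g \<in> W"
    and "u1 \<in> U" "u2 \<in> U" "w1 \<in> W" "w2 \<in> W" "fadd u1 w1 = fadd u2 w2"
  shows "u1 = u2"
proof -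
  have "fminus u1 u2 = fminus w2 w1"
    using fun_cong[OF assms(8)] by (auto simp: fadd_def fminus_def fun_eq_iff algebra_simps)
  moreover have "fminus u1 u2 \<in> U" and "fminus w2 w1 \<in> W" using assms(2-7) by simp_all
  ultimately have "fminus u1 u2 \<in> U \<inter> W" by simp
  then show ?thesis using assms(1) by (auto simp: fminus_def fun_eq_iff)
qed

lemma direct_sum_component_SOME:
  assumes "U \<inter> W = {\<lambda>x. 0}"
    and "\<And>f g. f \<in> U \<Longrightarrow> g \<in> U \<Longrightarrow> fminus f g \<in> U"
    and "\<And>f g. f \<in> W \<Longrightarrow> g \<in> W \<Longrightarrow> fminus f g \<in> W"
    and "u \<in> U" "w \<in> W"
  shows "(SOME u'. u' \<in> U \<and> (\<exists>w'\<in>W. fadd u w = fadd u' w')) = u" (is "?u' = u")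
proof -
  have "\<exists>u'. u' \<in> U \<and> (\<exists>w'\<in>W. fadd u w = fadd u' w')" using assms(4,5) by blast
  then have u': "?u' \<in> U \<and> (\<exists>w'\<in>W. fadd u w = fadd ?u' w')" by (rule someI_ex)
  then obtain w' where w': "w' \<in> W" "fadd u w = fadd ?u' w'" by blast
  show ?thesis
    by (rule direct_sum_component_unique
        [OF assms(1-3) conjunct1[OF u'] assms(4) w'(1) assms(5) w'(2)[symmetric]])
qed

lemma M_ideal_imp_L_projection:
  assumes "M_ideal J"
  shows "\<exists>L. L_projection J L"
proof -
  obtain W where W:
      "\<forall>f\<in>W. \<forall>g\<in>W. fadd f g \<in> W" "\<forall>f\<in>W. \<forall>c. fscale c f \<in> W"
      "\<forall>f\<in>Xdual. \<exists>u\<in>Xannih J. \<exists>w\<in>W. f = fadd u w"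
      "Xannih J \<inter> W = {\<lambda>x. 0}"
      "\<forall>u\<in>Xannih J. \<forall>w\<in>W. Xdnorm (fadd u w) = Xdnorm u + Xdnorm w"
    using assms unfolding M_ideal_def by blast
  have zero_W: "(\<lambda>x. 0) \<in> W" using W(4) by blast
  have fminus_W: "fminus f g \<in> W" if "f \<in> W" "g \<in> W" for f g
    using W(1,2) that by (simp add: fminus_eq_fadd_fscale)
  define L where "L f = (SOME u. u \<in> Xannih J \<and> (\<exists>w\<in>W. f = fadd u w))" for f
  have L_eq: "L (fadd u w) = u" if "u \<in> Xannih J" "w \<in> W" for u w
    unfolding L_def by (rule direct_sum_component_SOME[OF W(4) annih_fminus fminus_W that])
  have fadd_L_complement: "fadd (L f) (fminus f (L f)) = f" for f
    by (simp add: fadd_def fminus_def)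
  have decompose: "L f \<in> Xannih J \<and> fminus f (L f) \<in> W" if f: "f \<in> Xdual" for f
  proof -
    obtain u w where uw: "u \<in> Xannih J" "w \<in> W" "f = fadd u w" using W(3) f by blast
    then have "L f = u" using L_eq by simp
    moreover have "fminus f u = w" using uw(3) by (simp add: fadd_def fminus_def)
    ultimately show ?thesis using uw(1,2) by simp
  qed
  have "L_projection J L"
  proof
    fix f g :: "'a \<Rightarrow> real" and c :: real
    assume f: "f \<in> Xdual"
    note uw = decompose[OF f, THEN conjunct1] decompose[OF f, THEN conjunct2]
    show "L f \<in> Xannih J" by (fact uw(1))
    show "Xdnorm f = Xdnorm (L f) + Xdnorm (fminus f (L f))"
      using W(5) uw fadd_L_complement by metis
    have "L (fadd (fscale c (L f)) (fscale c (fminus f (L f)))) = fscale c (L f)"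
      using L_eq[OF annih_fscale[OF uw(1)]] W(2) uw(2) by simp
    then show "L (fscale c f) = fscale c (L f)"
      by (simp add: fadd_def fscale_def fminus_def algebra_simps)
    assume g: "g \<in> Xdual"
    note uw' = decompose[OF g, THEN conjunct1] decompose[OF g, THEN conjunct2]
    have "L (fadd (fadd (L f) (L g)) (fadd (fminus f (L f)) (fminus g (L g)))) = fadd (L f) (L g)"
      using L_eq[OF annih_fadd[OF uw(1) uw'(1)]] W(1) uw(2) uw'(2) by simp
    then show "L (fadd f g) = fadd (L f) (L g)"
      by (simp add: fadd_def fminus_def algebra_simps)
  next
    fix u :: "'a \<Rightarrow> real"
    assume "u \<in> Xannih J"
    then show "L u = u" using L_eq[OF _ zero_W] by (simp add: fadd_def)
  qed
  then show ?thesis by blast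
qed

locale HB_projection =
  fixes S :: "'v set" and add :: "'v \<Rightarrow> 'v \<Rightarrow> 'v" and sc :: "real \<Rightarrow> 'v \<Rightarrow> 'v"
    and N :: "'v \<Rightarrow> real" and V :: "'v set" and P :: "('v \<Rightarrow> real) \<Rightarrow> 'v \<Rightarrow> real"
  assumes proj_in_dual: "f \<in> dual_sp S add sc N \<Longrightarrow> P f \<in> dual_sp S add sc N"
    and proj_fadd: "f \<in> dual_sp S add sc N \<Longrightarrow> g \<in> dual_sp S add sc N \<Longrightarrow>
      P (fadd f g) = fadd (P f) (P g)"
    and proj_fscale: "f \<in> dual_sp S add sc N \<Longrightarrow> P (fscale c f) = fscale c (P f)"
    and proj_idem: "f \<in> dual_sp S add sc N \<Longrightarrow> P (P f) = P f"
    and proj_range: "P ` dual_sp S add sc N = annih S add sc N V"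
    and proj_norm_bdd: "bdd_above {dnorm S N (P f) | f. f \<in> dual_sp S add sc N \<and> dnorm S N f \<le> 1}"
    and proj_norm: "Sup {dnorm S N (P f) | f. f \<in> dual_sp S add sc N \<and> dnorm S N f \<le> 1} = 1"
    and proj_HB: "g \<in> (\<lambda>f. fminus f (P f)) ` dual_sp S add sc N \<Longrightarrow> u \<in> annih S add sc N V \<Longrightarrow>
      u \<noteq> (\<lambda>x. 0) \<Longrightarrow> dnorm S N g < dnorm S N (fadd g u) \<and> dnorm S N u \<le> dnorm S N (fadd g u)"

lemma has_HB_iff: "has_HB S add sc N V \<longleftrightarrow> (\<exists>P. HB_projection S add sc N V P)"
  unfolding has_HB_def HB_projection_def by (intro ex_cong1) (auto simp: Ball_def)

locale quotient_HB_lifting = L_projection J L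
  + Q: HB_projection "quot_carrier J" "qadd J" "qscale J" qnorm "coset J ` Y" Q
  for J Y :: "'a::real_normed_vector set" and L Q +
  assumes subspace_J: "subspace J" and J_subset_Y: "J \<subseteq> Y"
begin

definition P :: "('a \<Rightarrow> real) \<Rightarrow> 'a \<Rightarrow> real" where
  "P f = lift_functional J (Q (quot_functional J (L f)))"

lemma quot_L_in_quot_dual: "f \<in> Xdual \<Longrightarrow> quot_functional J (L f) \<in> quot_dual J"
  by (simp add: L_in_Xannih quot_functional_in_quot_dual subspace_J)

lemma P_in_Xannih: "f \<in> Xdual \<Longrightarrow> P f \<in> Xannih Y"
  unfolding P_def
  using lift_functional_in_Xannih_of_coset_image[OF subspace_J] Q.proj_range quot_L_in_quot_dual
  by blast

lemma P_in_Xdual: "f \<in> Xdual \<Longrightarrow> P f \<in> Xdual"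
  using P_in_Xannih by (simp add: annih_def)

lemma P_lift: "p \<in> quot_dual J \<Longrightarrow> P (lift_functional J p) = lift_functional J (Q p)"
  unfolding P_def
  by (simp add: L_Xannih lift_functional_in_Xannih quot_lift_functional subspace_J)

lemma P_fadd: "f \<in> Xdual \<Longrightarrow> g \<in> Xdual \<Longrightarrow> P (fadd f g) = fadd (P f) (P g)"
  unfolding P_def
  by (simp add: L_fadd quot_functional_fadd Q.proj_fadd quot_L_in_quot_dual lift_functional_fadd)

lemma P_fscale: "f \<in> Xdual \<Longrightarrow> P (fscale c f) = fscale c (P f)"
  unfolding P_def
  by (simp add: L_fscale quot_functional_fscale Q.proj_fscale quot_L_in_quot_dual lift_functional_fscale)

lemma P_idem: "f \<in> Xdual \<Longrightarrow> P (P f) = P f"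
  using P_lift[OF Q.proj_in_dual[OF quot_L_in_quot_dual]] Q.proj_idem[OF quot_L_in_quot_dual]
  by (simp add: P_def)

lemma P_range: "P ` Xdual = Xannih Y"
proof
  show "P ` Xdual \<subseteq> Xannih Y" using P_in_Xannih by blast
  show "Xannih Y \<subseteq> P ` Xdual"
  proof
    fix v assume v: "v \<in> Xannih Y"
    have vJ: "v \<in> Xannih J" using annih_antimono[OF J_subset_Y] v by blast
    obtain p where p: "p \<in> quot_dual J" "quot_functional J v = Q p"
      using quot_functional_in_annih_coset_image[OF subspace_J J_subset_Y v] Q.proj_range
      by (metis imageE)
    have "P (lift_functional J p) = v"
      using P_lift[OF p(1)] p(2) lift_quot_functional[OF subspace_J vJ] by simp
    moreover have "lift_functional J p \<in> Xdual"
      using lift_functional_in_Xannih[OF subspace_J p(1)] by (simp add: annih_def)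
    ultimately show "v \<in> P ` Xdual" by blast
  qed
qed

lemma P_norm_values:
  "{Xdnorm (P f) | f. f \<in> Xdual \<and> Xdnorm f \<le> 1}
    = {quot_dnorm J (Q p) | p. p \<in> quot_dual J \<and> quot_dnorm J p \<le> 1}"
proof (intro set_eqI iffI)
  fix r assume "r \<in> {Xdnorm (P f) | f. f \<in> Xdual \<and> Xdnorm f \<le> 1}"
  then obtain f where f: "r = Xdnorm (P f)" "f \<in> Xdual" "Xdnorm f \<le> 1" by blast
  have "quot_dnorm J (quot_functional J (L f)) \<le> 1"
    using quot_dnorm_quot_functional[OF subspace_J L_in_Xannih[OF f(2)]] Xdnorm_L_le[OF f(2)] f(3)
    by simp
  moreover have "r = quot_dnorm J (Q (quot_functional J (L f)))"
    using f(1) Xdnorm_lift_functional[OF subspace_J Q.proj_in_dual[OF quot_L_in_quot_dual[OF f(2)]]]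
    by (simp add: P_def)
  ultimately show "r \<in> {quot_dnorm J (Q p) | p. p \<in> quot_dual J \<and> quot_dnorm J p \<le> 1}"
    using quot_L_in_quot_dual[OF f(2)] by blast
next
  fix r assume "r \<in> {quot_dnorm J (Q p) | p. p \<in> quot_dual J \<and> quot_dnorm J p \<le> 1}"
  then obtain p where p: "r = quot_dnorm J (Q p)" "p \<in> quot_dual J" "quot_dnorm J p \<le> 1"
    by blast
  have "Xdnorm (P (lift_functional J p)) = r"
    using P_lift[OF p(2)] Xdnorm_lift_functional[OF subspace_J Q.proj_in_dual[OF p(2)]] p(1)
    by simp
  moreover have "Xdnorm (lift_functional J p) \<le> 1"
    using Xdnorm_lift_functional[OF subspace_J p(2)] p(3) by simp
  moreover have "lift_functional J p \<in> Xdual"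
    using lift_functional_in_Xannih[OF subspace_J p(2)] by (simp add: annih_def)
  ultimately show "r \<in> {Xdnorm (P f) | f. f \<in> Xdual \<and> Xdnorm f \<le> 1}" by blast
qed

lemma L_minus_P_in_Xannih: "f \<in> Xdual \<Longrightarrow> fminus (L f) (P f) \<in> Xannih J"
  using annih_fminus L_in_Xannih annih_antimono[OF J_subset_Y] P_in_Xannih by blast

lemma quot_L_minus_P:
  assumes "f \<in> Xdual"
  shows "quot_functional J (fminus (L f) (P f))
    = fminus (quot_functional J (L f)) (Q (quot_functional J (L f)))"
  unfolding P_def quot_functional_fminus
  using quot_lift_functional[OF subspace_J Q.proj_in_dual[OF quot_L_in_quot_dual[OF assms]]]
  by simp

lemma P_HB:
  assumes g: "g \<in> (\<lambda>f. fminus f (P f)) ` Xdual" and v: "v \<in> Xannih Y" "v \<noteq> (\<lambda>x. 0)"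
  shows "Xdnorm g < Xdnorm (fadd g v) \<and> Xdnorm v \<le> Xdnorm (fadd g v)"
proof -
  obtain f where f: "f \<in> Xdual" and g_eq: "g = fminus f (P f)" using g by blast
  define h where "h = fminus (L f) (P f)"
  let ?w = "fminus f (L f)"
  have vJ: "v \<in> Xannih J" using annih_antimono[OF J_subset_Y] v(1) by blast
  have hJ: "h \<in> Xannih J" unfolding h_def by (rule L_minus_P_in_Xannih[OF f])
  have hvJ: "fadd h v \<in> Xannih J" by (rule annih_fadd[OF hJ vJ])
  have "quot_dnorm J (quot_functional J h) < quot_dnorm J (quot_functional J (fadd h v))
      \<and> quot_dnorm J (quot_functional J v) \<le> quot_dnorm J (quot_functional J (fadd h v))"
    unfolding quot_functional_fadd h_def quot_L_minus_P[OF f]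
    using Q.proj_HB quot_L_in_quot_dual[OF f]
      quot_functional_in_annih_coset_image[OF subspace_J J_subset_Y v(1)]
      quot_functional_nonzero[OF subspace_J vJ v(2)]
    by blast
  then have h_HB: "Xdnorm h < Xdnorm (fadd h v) \<and> Xdnorm v \<le> Xdnorm (fadd h v)"
    by (simp add: quot_dnorm_quot_functional[OF subspace_J] hJ vJ hvJ)
  have "g = fadd h ?w"
    unfolding g_eq h_def by (simp add: fadd_def fminus_def fun_eq_iff)
  then have "Xdnorm g = Xdnorm h + Xdnorm ?w"
    and "Xdnorm (fadd g v) = Xdnorm (fadd h v) + Xdnorm ?w"
    using Xdnorm_fadd_L_complement[OF f hJ] Xdnorm_fadd_L_complement[OF f hvJ]
    by (simp_all add: fadd_def add_ac)
  then show ?thesis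
    using h_HB Xdnorm_nonneg[OF L_complement_in_Xdual[OF f]] by linarith
qed

sublocale HB_projection UNIV "(+)" "(*\<^sub>R)" norm Y P
proof
  show "P ` Xdual = Xannih Y" by (fact P_range)
  show "bdd_above {Xdnorm (P f) | f. f \<in> Xdual \<and> Xdnorm f \<le> 1}"
    using Q.proj_norm_bdd by (simp add: P_norm_values)
  show "Sup {Xdnorm (P f) | f. f \<in> Xdual \<and> Xdnorm f \<le> 1} = 1"
    using Q.proj_norm by (simp add: P_norm_values)
qed (simp_all add: P_in_Xdual P_fadd P_fscale P_idem P_HB)

end

theorem theorem3p11:
  fixes J Y :: "'a::banach set"
  assumes "closed J" and "subspace J" and "closed Y" and "subspace Y"
    and "J \<subseteq> Y"
    and "M_ideal J"
    and "has_HB (quot_carrier J) (qadd J) (qscale J) qnorm (coset J ` Y)"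
  shows "has_HB UNIV (+) (*\<^sub>R) norm Y"
proof -
  obtain L where "L_projection J L" using M_ideal_imp_L_projection[OF assms(6)] by blast
  moreover obtain Q where "HB_projection (quot_carrier J) (qadd J) (qscale J) qnorm (coset J ` Y) Q"
    using assms(7) has_HB_iff by blast
  ultimately interpret quotient_HB_lifting J Y L Q
    using assms(2,5) by (simp add: quotient_HB_lifting_def quotient_HB_lifting_axioms_def)
  show ?thesis using has_HB_iff HB_projection_axioms by blast
qed

end
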